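(* Let $R$ be a commutative ring, and let $\mathfrak a,\mathfrak b\subseteq R$ be ideals. a) If $\mathfrak a$ and $\mathfrak b$ are half-centred, then so is $\mathfrak a+\mathfrak b$. b) If $\mathfrak a$ is centred and $\mathfrak b$ is well-centred or weakly fair, then $\mathfrak a+\mathfrak b$ is centred. c) If $\mathfrak a$ and $\mathfrak b$ are well-centred, then so is $\mathfrak a+\mathfrak b$.
   Context: Rings are commutative with unit (possibly zero). For a ring $R$, an ideal $\mathfrak a\subseteq R$ and an $R$-module $M$: $\operatorname{Var}(\mathfrak a)=\{\mathfrak p\in\operatorname{Spec}(R)\mid\mathfrak a\subseteq\mathfrak p\}$; $\Gamma_{\mathfrak a}(M)=\{x\in M\mid\exists n\in\mathbb N:\mathfrak a^n\subseteq(0:_Rx)\}$; $\operatorname{Ass}^{\mathrm f}_R(M)=\{\mathfrak p\in\operatorname{Spec}(R)\mid\exists x\in M:\mathfrak p\in\min(0:_Rx)\}$ (weak assassin), where $\min(\mathfrak b)$ is the set of minimal elements of $\operatorname{Var}(\mathfrak b)$. The ideal $\mathfrak a$ is weakly fair if $\operatorname{Ass}^{\mathrm f}_R(M/\Gamma_{\mathfrak a}(M))=\operatorname{Ass}^{\mathrm f}_R(M)\setminus\operatorname{Var}(\mathfrak a)$ for every $R$-module $M$; centred if, for every $R$-module $M$, $\Gamma_{\mathfrak a}(M)=0\Leftrightarrow\operatorname{Ass}^{\mathrm f}_R(M)\cap\operatorname{Var}(\mathfrak a)=\emptyset$; half-centred if, for every $R$-module $M$, $\Gamma_{\mathfrak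 a}(M)=M\Leftrightarrow\operatorname{Ass}^{\mathrm f}_R(M)\subseteq\operatorname{Var}(\mathfrak a)$; well-centred if it is both centred and half-centred. *)

theory Defs
  imports "HOL-Algebra.Module" "HOL-Algebra.Ideal_Product"
begin

section \<open>Spectrum, annihilators, torsion\<close>

definition ideal_variety :: "('r, 'x) ring_scheme \<Rightarrow> 'r set \<Rightarrow> 'r set set"
  where "ideal_variety R \<aa> = {\<pp>. primeideal \<pp> R \<and> \<aa> \<subseteq> \<pp>}"

definition minimal_primes :: "('r, 'x) ring_scheme \<Rightarrow> 'r set \<Rightarrow> 'r set set"
  where "minimal_primes R \<bb> =
    {\<pp> \<in> ideal_variety R \<bb>. \<forall>\<qq> \<in> ideal_variety R \<bb>. \<qq> \<subseteq> \<pp> \<longrightarrow> \<qq> = \<pp>}"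

definition elem_annihilator ::
    "('r, 'x) ring_scheme \<Rightarrow> ('r, 'm, 'y) module_scheme \<Rightarrow> 'm \<Rightarrow> 'r set"
  where "elem_annihilator R M x = {r \<in> carrier R. r \<odot>\<^bsub>M\<^esub> x = \<zero>\<^bsub>M\<^esub>}"

text \<open>Powers of ideals are taken in the library's monoid of ideals, whose unit is the
  whole ring; so the zeroth power of any ideal is \<^term>\<open>carrier R\<close>.\<close>

definition torsion_part ::
    "('r, 'x) ring_scheme \<Rightarrow> 'r set \<Rightarrow> ('r, 'm, 'y) module_scheme \<Rightarrow> 'm set"
  where "torsion_part R \<aa> M =
    {x \<in> carrier M. \<exists>n::nat. \<aa> [^]\<^bsub>ideals_set R\<^esub> n \<subseteq> elem_annihilator R M x}"

definition weak_assassin ::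
    "('r, 'x) ring_scheme \<Rightarrow> ('r, 'm, 'y) module_scheme \<Rightarrow> 'r set set"
  where "weak_assassin R M =
    {\<pp>. primeideal \<pp> R \<and> (\<exists>x \<in> carrier M. \<pp> \<in> minimal_primes R (elem_annihilator R M x))}"

text \<open>The fields \<^const>\<open>mult\<close> and \<^const>\<open>one\<close> of a module record carry no meaning and are
  not constrained by \<^locale>\<open>module\<close>.\<close>

definition quot_module :: "('r, 'm, 'y) module_scheme \<Rightarrow> 'm set \<Rightarrow> ('r, 'm set) module"
  where "quot_module M N =
    \<lparr>carrier = a_rcosets\<^bsub>M\<^esub> N, mult = undefined, one = undefined,
     zero = N, add = set_add M,
     smult = (\<lambda>r C. \<Union>x\<in>C. N +>\<^bsub>M\<^esub> (r \<odot>\<^bsub>M\<^esub> x))\<rparr>"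


section \<open>Fairness and centredness\<close>

text \<open>HOL cannot quantify over types inside a formula, so the quantification over all
  modules is over all modules with carrier in a type \<open>'m\<close>, passed as an argument.
  This argument is harmless: by the lemmas \<open>weakly_fair_universal\<close>,
  \<open>centred_universal\<close> and \<open>half_centred_universal\<close> below, each property for the type
  \<open>'r set\<close>, where \<open>'r\<close> is the type of ring elements, implies the same property for
  every type.\<close>

definition weakly_fair :: "'m itself \<Rightarrow> ('r, 'x) ring_scheme \<Rightarrow> 'r set \<Rightarrow> bool"
  where "weakly_fair _ R \<aa> \<longleftrightarrow>
    (\<forall>M :: ('r, 'm) module. module R M \<longrightarrow>
       weak_assassin R (quot_module M (torsion_part R \<aa> M))
         = weak_assassin R M - ideal_variety R \<aa>)"

definition centred :: "'m itself \<Rightarrow> ('r, 'x) ring_scheme \<Rightarrow> 'r set \<Rightarrow> bool"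
  where "centred _ R \<aa> \<longleftrightarrow>
    (\<forall>M :: ('r, 'm) module. module R M \<longrightarrow>
       (torsion_part R \<aa> M = {\<zero>\<^bsub>M\<^esub>} \<longleftrightarrow> weak_assassin R M \<inter> ideal_variety R \<aa> = {}))"

definition half_centred :: "'m itself \<Rightarrow> ('r, 'x) ring_scheme \<Rightarrow> 'r set \<Rightarrow> bool"
  where "half_centred _ R \<aa> \<longleftrightarrow>
    (\<forall>M :: ('r, 'm) module. module R M \<longrightarrow>
       (torsion_part R \<aa> M = carrier M \<longleftrightarrow> weak_assassin R M \<subseteq> ideal_variety R \<aa>))"

definition well_centred :: "'m itself \<Rightarrow> ('r, 'x) ring_scheme \<Rightarrow> 'r set \<Rightarrow> bool"
  where "well_centred T R \<aa> \<longleftrightarrow> centred T R \<aa> \<and> half_centred T R \<aa>"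


section \<open>Quotient modules\<close>

lemma comm_group_extend:
  assumes "comm_group \<lparr>carrier = c, mult = m, one = e, \<dots> = u\<rparr>"
  shows "comm_group \<lparr>carrier = c, mult = m, one = e, \<dots> = v\<rparr>"
  using assms
  unfolding comm_group_def comm_monoid_def group_def Group.monoid_def comm_monoid_axioms_def
    group_axioms_def Units_def monoid.select_convs partial_object.select_convs
  by assumption

lemma subgroup_extend:
  assumes "subgroup H \<lparr>carrier = c, mult = m, one = e, \<dots> = u\<rparr>"
  shows "subgroup H \<lparr>carrier = c, mult = m, one = e, \<dots> = v\<rparr>"
  using assms unfolding subgroup_def m_inv_def by simp

context module
begin

lemma submodule_abelian_subgroup:
  assumes "submodule H R M"
  shows "abelian_subgroup H M"
  using assms by (intro abelian_subgroupI3 additive_subgroupI M.abelian_group_axioms)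
    (simp add: submodule_def)

lemma quot_smult:
  assumes H: "submodule H R M" and r: "r \<in> carrier R" and x: "x \<in> carrier M"
  shows "r \<odot>\<^bsub>quot_module M H\<^esub> (H +>\<^bsub>M\<^esub> x) = H +>\<^bsub>M\<^esub> (r \<odot>\<^bsub>M\<^esub> x)"
proof -
  interpret H: abelian_subgroup H M by (rule submodule_abelian_subgroup[OF H])
  have "H +>\<^bsub>M\<^esub> (r \<odot>\<^bsub>M\<^esub> y) = H +>\<^bsub>M\<^esub> (r \<odot>\<^bsub>M\<^esub> x)" if "y \<in> H +>\<^bsub>M\<^esub> x" for y
  proof -
    from that obtain h where h: "h \<in> H" "y = h \<oplus>\<^bsub>M\<^esub> x" by (auto simp: a_r_coset_def')
    have hM: "h \<in> carrier M" using h(1) H.a_subset by blast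
    have "r \<odot>\<^bsub>M\<^esub> y = r \<odot>\<^bsub>M\<^esub> h \<oplus>\<^bsub>M\<^esub> r \<odot>\<^bsub>M\<^esub> x" using h hM r x by (simp add: smult_r_distr)
    moreover have "r \<odot>\<^bsub>M\<^esub> h \<in> H" using submoduleE(4)[OF H] r h by blast
    ultimately have "r \<odot>\<^bsub>M\<^esub> y \<in> H +>\<^bsub>M\<^esub> (r \<odot>\<^bsub>M\<^esub> x)" by (auto simp: a_r_coset_def')
    then show ?thesis
      using H.a_repr_independence'[of _ "r \<odot>\<^bsub>M\<^esub> x"] smult_closed[OF r x] by simp
  qed
  moreover have "x \<in> H +>\<^bsub>M\<^esub> x" by (rule H.a_rcos_self[OF x])
  ultimately have "(\<Union>y\<in>H +>\<^bsub>M\<^esub> x. H +>\<^bsub>M\<^esub> (r \<odot>\<^bsub>M\<^esub> y)) = H +>\<^bsub>M\<^esub> (r \<odot>\<^bsub>M\<^esub> x)"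
    by blast
  then show ?thesis by (simp add: quot_module_def)
qed

lemma carrier_quot: "carrier (quot_module M H) = (\<lambda>x. H +>\<^bsub>M\<^esub> x) ` carrier M"
  by (auto simp: quot_module_def A_RCOSETS_def')

lemma quot_zero: "\<zero>\<^bsub>quot_module M H\<^esub> = H"
  by (simp add: quot_module_def)

lemma quot_is_module:
  assumes H: "submodule H R M"
  shows "module R (quot_module M H)"
proof -
  interpret H: abelian_subgroup H M by (rule submodule_abelian_subgroup[OF H])
  have add: "(H +>\<^bsub>M\<^esub> x) \<oplus>\<^bsub>quot_module M H\<^esub> (H +>\<^bsub>M\<^esub> y) = H +>\<^bsub>M\<^esub> (x \<oplus>\<^bsub>M\<^esub> y)"
    if "x \<in> carrier M" "y \<in> carrier M" for x y
    using H.a_rcos_sum[OF that] by (simp add: quot_module_def)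
  have ab: "abelian_group (quot_module M H)"
    by (rule comm_group_abelian_groupI)
      (use H.a_factorgroup_is_comm_group in
        \<open>auto simp: quot_module_def A_FactGroup_def' intro: comm_group_extend\<close>)
  show ?thesis
    by (rule moduleI[OF R.is_cring ab]; unfold carrier_quot;
        (elim imageE)?; hypsubst?;
        simp only: quot_smult[OF H] add smult_l_distr smult_r_distr smult_assoc1 smult_closed
          R.add.m_closed R.m_closed M.add.m_closed R.one_closed smult_one image_eqI)
qed

lemma ann_quot:
  assumes H: "submodule H R M" and x: "x \<in> carrier M"
  shows "elem_annihilator R (quot_module M H) (H +>\<^bsub>M\<^esub> x) = {s \<in> carrier R. s \<odot>\<^bsub>M\<^esub> x \<in> H}"
proof -
  interpret H: abelian_subgroup H M by (rule submodule_abelian_subgroup[OF H])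
  have coset: "H +>\<^bsub>M\<^esub> y = H \<longleftrightarrow> y \<in> H" if "y \<in> carrier M" for y
    using H.a_rcos_self[OF that] H.a_rcos_const[of y] by auto
  have "s \<odot>\<^bsub>quot_module M H\<^esub> (H +>\<^bsub>M\<^esub> x) = H \<longleftrightarrow> s \<odot>\<^bsub>M\<^esub> x \<in> H"
    if "s \<in> carrier R" for s
    unfolding quot_smult[OF H that x] by (rule coset[OF smult_closed[OF that x]])
  then show ?thesis
    unfolding elem_annihilator_def quot_zero by blast
qed

lemma ann_ideal:
  assumes x: "x \<in> carrier M"
  shows "ideal (elem_annihilator R M x) R"
proof (rule idealI)
  show "subgroup (elem_annihilator R M x) (add_monoid R)"
  proof (rule R.add.subgroupI)
    show "elem_annihilator R M x \<noteq> {}"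
      using x by (auto simp: elem_annihilator_def intro!: exI[of _ \<zero>])
  qed (use x in \<open>auto simp: elem_annihilator_def smult_l_minus smult_l_distr\<close>)
next
  fix a r assume "a \<in> elem_annihilator R M x" "r \<in> carrier R"
  then show ra: "r \<otimes> a \<in> elem_annihilator R M x"
    using x by (auto simp: elem_annihilator_def smult_assoc1)
  then show "a \<otimes> r \<in> elem_annihilator R M x"
    using \<open>a \<in> _\<close> \<open>r \<in> _\<close> by (simp add: R.m_comm elem_annihilator_def)
qed (rule R.ring_axioms)

lemma ideal_pow:
  assumes "ideal \<aa> R"
  shows "ideal (\<aa> [^]\<^bsub>ideals_set R\<^esub> (n::nat)) R"
  by (induction n)
    (auto simp: nat_pow_def ideals_set_def R.oneideal intro!: R.ideal_prod_is_ideal assms)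

lemma ideal_pow_antimono:
  assumes a: "ideal \<aa> R" and "m \<le> n"
  shows "\<aa> [^]\<^bsub>ideals_set R\<^esub> (n::nat) \<subseteq> \<aa> [^]\<^bsub>ideals_set R\<^esub> m"
  using \<open>m \<le> n\<close>
proof (induction n rule: dec_induct)
  case (step n)
  have "\<aa> [^]\<^bsub>ideals_set R\<^esub> Suc n = (\<aa> [^]\<^bsub>ideals_set R\<^esub> n) \<cdot>\<^bsub>R\<^esub> \<aa>"
    by (simp add: nat_pow_def ideals_set_def)
  also have "\<dots> \<subseteq> \<aa> [^]\<^bsub>ideals_set R\<^esub> n"
    using R.ideal_prod_inter[OF ideal_pow[OF a] a] by blast
  finally show ?case using step by blast
qed simp

lemma torsion_submodule:
  assumes a: "ideal \<aa> R"
  shows "submodule (torsion_part R \<aa> M) R M"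
proof (rule submoduleI)
  note [simp] = elem_annihilator_def
  show "torsion_part R \<aa> M \<subseteq> carrier M" by (auto simp: torsion_part_def)
  show "\<zero>\<^bsub>M\<^esub> \<in> torsion_part R \<aa> M"
    using ideal.Icarr[OF ideal_pow[OF a, of 0]] by (auto simp: torsion_part_def intro!: exI[of _ 0])
  show "\<ominus>\<^bsub>M\<^esub> x \<in> torsion_part R \<aa> M" if "x \<in> torsion_part R \<aa> M" for x
    using that by (fastforce simp: torsion_part_def smult_r_minus)
  show "x \<oplus>\<^bsub>M\<^esub> y \<in> torsion_part R \<aa> M"
    if xy: "x \<in> torsion_part R \<aa> M" "y \<in> torsion_part R \<aa> M" for x y
  proof -
    obtain m n :: nat where
      mn: "\<aa> [^]\<^bsub>ideals_set R\<^esub> m \<subseteq> elem_annihilator R M x"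
          "\<aa> [^]\<^bsub>ideals_set R\<^esub> n \<subseteq> elem_annihilator R M y"
      using xy unfolding torsion_part_def by blast
    have "\<aa> [^]\<^bsub>ideals_set R\<^esub> (max m n) \<subseteq> elem_annihilator R M x \<inter> elem_annihilator R M y"
      using mn ideal_pow_antimono[OF a, of m "max m n"] ideal_pow_antimono[OF a, of n "max m n"]
      by auto
    also have "\<dots> \<subseteq> elem_annihilator R M (x \<oplus>\<^bsub>M\<^esub> y)"
      using xy by (auto simp: torsion_part_def smult_r_distr)
    finally show ?thesis using xy by (auto simp: torsion_part_def simp del: elem_annihilator_def)
  qed
  show "r \<odot>\<^bsub>M\<^esub> x \<in> torsion_part R \<aa> M"
    if r: "r \<in> carrier R" and x: "x \<in> torsion_part R \<aa> M" for r x
  proof -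
    have "elem_annihilator R M x \<subseteq> elem_annihilator R M (r \<odot>\<^bsub>M\<^esub> x)"
      if "x \<in> carrier M"
    proof
      fix s assume s: "s \<in> elem_annihilator R M x"
      then have "s \<odot>\<^bsub>M\<^esub> (r \<odot>\<^bsub>M\<^esub> x) = r \<odot>\<^bsub>M\<^esub> (s \<odot>\<^bsub>M\<^esub> x)"
        using r that smult_assoc1[of s r x] smult_assoc1[of r s x] R.m_comm[of r s] by auto
      then show "s \<in> elem_annihilator R M (r \<odot>\<^bsub>M\<^esub> x)" using s r by auto
    qed
    then show ?thesis
      using r x by (auto simp: torsion_part_def simp del: elem_annihilator_def)
  qed
qed


section \<open>Independence of the carrier type\<close>

lemma ring_self_module:
  "module R \<lparr>carrier = carrier R, mult = mult R, one = \<one>, zero = \<zero>, add = add R, smult = mult R\<rparr>"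
    (is "module R ?S")
proof -
  have "abelian_group ?S"
    by (rule comm_group_abelian_groupI)
      (use R.a_comm_group in \<open>auto intro: comm_group_extend\<close>)
  then show ?thesis
    by (rule moduleI[OF R.is_cring]) (simp_all add: R.l_distr R.r_distr R.m_assoc)
qed

text \<open>The cyclic submodule generated by \<open>x\<close> has an isomorphic copy, the quotient of \<open>R\<close>
  by the annihilator of \<open>x\<close>, with carrier in \<open>'a set\<close>.\<close>

lemma cyclic_copy:
  assumes x: "x \<in> carrier M"
  obtains N :: "('a, 'a set) module" and g where
    "module R N" "carrier N = g ` carrier R"
    "\<And>r. r \<in> carrier R \<Longrightarrow> elem_annihilator R N (g r) = elem_annihilator R M (r \<odot>\<^bsub>M\<^esub> x)"
    "\<And>r s. r \<in> carrier R \<Longrightarrow> s \<in> carrier R \<Longrightarrow> s \<odot>\<^bsub>N\<^esub> g r = g (s \<otimes> r)"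
proof -
  define S where "S = \<lparr>carrier = carrier R, mult = mult R, one = \<one>, zero = \<zero>,
    add = add R, smult = mult R\<rparr>"
  define J where "J = elem_annihilator R M x"
  have S: "carrier S = carrier R" "smult S = mult R"
    and addS: "add_monoid S = \<lparr>carrier = carrier R, mult = add R, one = \<zero>, \<dots> = undefined\<rparr>"
    by (simp_all add: S_def)
  have modS: "module R S" unfolding S_def by (rule ring_self_module)
  interpret J: ideal J R unfolding J_def by (rule ann_ideal[OF x])
  have "subgroup J (add_monoid S)"
    unfolding addS by (rule subgroup_extend[OF J.a_subgroup])
  then have sub: "submodule J R S"
    using J.I_l_closed by (intro submodule.intro submodule_axioms.intro) (simp_all add: S)
  show thesis
  proof (rule that[of "quot_module S J" "\<lambda>r. J +>\<^bsub>S\<^esub> r"])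
    show "module R (quot_module S J)" by (rule module.quot_is_module[OF modS sub])
    show "carrier (quot_module S J) = (\<lambda>r. J +>\<^bsub>S\<^esub> r) ` carrier R"
      using module.carrier_quot[OF modS, of J] unfolding S .
    show "elem_annihilator R (quot_module S J) (J +>\<^bsub>S\<^esub> r) = elem_annihilator R M (r \<odot>\<^bsub>M\<^esub> x)"
      if r: "r \<in> carrier R" for r
    proof -
      have "elem_annihilator R (quot_module S J) (J +>\<^bsub>S\<^esub> r) = {s \<in> carrier R. s \<otimes> r \<in> J}"
        using module.ann_quot[OF modS sub, of r] r unfolding S by blast
      also have "\<dots> = elem_annihilator R M (r \<odot>\<^bsub>M\<^esub> x)"
        unfolding J_def elem_annihilator_def
        using r x smult_assoc1[of _ r x] by auto
      finally show ?thesis .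
    qed
    show "s \<odot>\<^bsub>quot_module S J\<^esub> (J +>\<^bsub>S\<^esub> r) = J +>\<^bsub>S\<^esub> (s \<otimes> r)"
      if "r \<in> carrier R" "s \<in> carrier R" for r s
      using module.quot_smult[OF modS sub, of s r] that unfolding S by blast
  qed
qed

lemma cyclic_copy_properties:
  assumes x: "x \<in> carrier M" and a: "ideal \<aa> R"
  obtains N :: "('a, 'a set) module" where
    "module R N"
    "weak_assassin R N \<subseteq> weak_assassin R M"
    "minimal_primes R (elem_annihilator R M x) \<subseteq> weak_assassin R N"
    "torsion_part R \<aa> N = carrier N \<longrightarrow> x \<in> torsion_part R \<aa> M"
    "torsion_part R \<aa> M = carrier M \<longrightarrow> torsion_part R \<aa> N = carrier N"
    "torsion_part R \<aa> N = {\<zero>\<^bsub>N\<^esub>} \<longrightarrow> x \<in> torsion_part R \<aa> M \<longrightarrow> x = \<zero>\<^bsub>M\<^esub>"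
    "torsion_part R \<aa> M = {\<zero>\<^bsub>M\<^esub>} \<longrightarrow> torsion_part R \<aa> N = {\<zero>\<^bsub>N\<^esub>}"
    "weak_assassin R (quot_module N (torsion_part R \<aa> N))
       \<subseteq> weak_assassin R (quot_module M (torsion_part R \<aa> M))"
    "minimal_primes R (elem_annihilator R (quot_module M (torsion_part R \<aa> M))
         (torsion_part R \<aa> M +>\<^bsub>M\<^esub> x))
       \<subseteq> weak_assassin R (quot_module N (torsion_part R \<aa> N))"
proof -
  obtain N :: "('a, 'a set) module" and g where N: "module R N"
    and cN: "carrier N = g ` carrier R"
    and ann: "\<And>r. r \<in> carrier R \<Longrightarrow>
      elem_annihilator R N (g r) = elem_annihilator R M (r \<odot>\<^bsub>M\<^esub> x)"
    and sm: "\<And>r s. r \<in> carrier R \<Longrightarrow> s \<in> carrier R \<Longrightarrow> s \<odot>\<^bsub>N\<^esub> g r = g (s \<otimes> r)"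
    using cyclic_copy[OF x] by metis
  interpret N: module R N by (rule N)
  have gN: "g r \<in> carrier N" if "r \<in> carrier R" for r using that cN by blast
  have prime: "primeideal \<pp> R" if "\<pp> \<in> minimal_primes R J" for \<pp> J
    using that by (auto simp: minimal_primes_def ideal_variety_def)
  have tors: "g r \<in> torsion_part R \<aa> N \<longleftrightarrow> r \<odot>\<^bsub>M\<^esub> x \<in> torsion_part R \<aa> M"
    if "r \<in> carrier R" for r
    using that x gN ann by (auto simp: torsion_part_def)
  have zero: "g r = \<zero>\<^bsub>N\<^esub> \<longleftrightarrow> r \<odot>\<^bsub>M\<^esub> x = \<zero>\<^bsub>M\<^esub>" if "r \<in> carrier R" for r
  proof -
    have "g r = \<zero>\<^bsub>N\<^esub> \<longleftrightarrow> \<one> \<in> elem_annihilator R N (g r)"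
      using N.smult_one[OF gN[OF that]] by (simp add: elem_annihilator_def)
    also have "\<dots> \<longleftrightarrow> r \<odot>\<^bsub>M\<^esub> x = \<zero>\<^bsub>M\<^esub>"
      using that x unfolding ann[OF that] by (simp add: elem_annihilator_def)
    finally show ?thesis .
  qed
  note subM = torsion_submodule[OF a] and subN = N.torsion_submodule[OF a]
  have annq: "elem_annihilator R (quot_module N (torsion_part R \<aa> N)) (torsion_part R \<aa> N +>\<^bsub>N\<^esub> g r)
      = elem_annihilator R (quot_module M (torsion_part R \<aa> M))
          (torsion_part R \<aa> M +>\<^bsub>M\<^esub> (r \<odot>\<^bsub>M\<^esub> x))" if "r \<in> carrier R" for r
    using that x gN by (auto simp: N.ann_quot[OF subN] ann_quot[OF subM] sm tors smult_assoc1)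
  show thesis
  proof (rule that[OF N])
    show "weak_assassin R N \<subseteq> weak_assassin R M"
      using x by (auto simp: weak_assassin_def cN ann)
    show "minimal_primes R (elem_annihilator R M x) \<subseteq> weak_assassin R N"
      using ann[of \<one>] x prime by (auto simp: weak_assassin_def cN intro!: bexI[of _ \<one>])
    show "torsion_part R \<aa> N = carrier N \<longrightarrow> x \<in> torsion_part R \<aa> M"
      using tors[of \<one>] gN[of \<one>] x by auto
    show "torsion_part R \<aa> M = carrier M \<longrightarrow> torsion_part R \<aa> N = carrier N"
    proof
      assume that: "torsion_part R \<aa> M = carrier M"
      have "carrier N \<subseteq> torsion_part R \<aa> N"
        using tors that x by (auto simp: cN)
      then show "torsion_part R \<aa> N = carrier N" by (auto simp: torsion_part_def)
    qed
    show "torsion_part R \<aa> N = {\<zero>\<^bsub>N\<^esub>} \<longrightarrow> x \<in> torsion_part R \<aa> M \<longrightarrow> x = \<zero>\<^bsub>M\<^esub>"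
      using tors[of \<one>] zero[of \<one>] x by auto
    show "torsion_part R \<aa> M = {\<zero>\<^bsub>M\<^esub>} \<longrightarrow> torsion_part R \<aa> N = {\<zero>\<^bsub>N\<^esub>}"
    proof
      assume M0: "torsion_part R \<aa> M = {\<zero>\<^bsub>M\<^esub>}"
      have "y = \<zero>\<^bsub>N\<^esub>" if "y \<in> torsion_part R \<aa> N" for y
      proof -
        have "y \<in> carrier N" using that by (simp add: torsion_part_def)
        then obtain r where "r \<in> carrier R" "y = g r" using cN by blast
        then show ?thesis using that tors zero M0 by simp
      qed
      moreover have "\<zero>\<^bsub>N\<^esub> \<in> torsion_part R \<aa> N"
      proof -
        obtain r where r: "r \<in> carrier R" "\<zero>\<^bsub>N\<^esub> = g r" using cN N.M.zero_closed by blast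
        then show ?thesis using tors[of r] zero[of r] M0 by simp
      qed
      ultimately show "torsion_part R \<aa> N = {\<zero>\<^bsub>N\<^esub>}" by blast
    qed
    show "weak_assassin R (quot_module N (torsion_part R \<aa> N))
       \<subseteq> weak_assassin R (quot_module M (torsion_part R \<aa> M))"
      using x by (auto simp: weak_assassin_def N.carrier_quot carrier_quot cN annq)
    show "minimal_primes R (elem_annihilator R (quot_module M (torsion_part R \<aa> M))
         (torsion_part R \<aa> M +>\<^bsub>M\<^esub> x))
       \<subseteq> weak_assassin R (quot_module N (torsion_part R \<aa> N))"
      using annq[of \<one>] x prime
      by (auto simp: weak_assassin_def N.carrier_quot cN intro!: bexI[of _ \<one>])
  qed
qed

end

lemma half_centred_universal:
  assumes a: "ideal \<aa> R" and h: "half_centred TYPE('r set) R (\<aa> :: 'r set)"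
  shows "half_centred TYPE('m) R \<aa>"
  unfolding half_centred_def
proof (intro allI impI iffI)
  fix M :: "('r, 'm) module" assume "module R M"
  then interpret M: module R M .
  note h' = h[unfolded half_centred_def, rule_format]
  {
    assume T: "torsion_part R \<aa> M = carrier M"
    show "weak_assassin R M \<subseteq> ideal_variety R \<aa>"
    proof
      fix \<pp> assume "\<pp> \<in> weak_assassin R M"
      then obtain x where x: "x \<in> carrier M" "\<pp> \<in> minimal_primes R (elem_annihilator R M x)"
        by (auto simp: weak_assassin_def)
      obtain N :: "('r, 'r set) module" where N: "module R N"
        "minimal_primes R (elem_annihilator R M x) \<subseteq> weak_assassin R N"
        "torsion_part R \<aa> M = carrier M \<longrightarrow> torsion_part R \<aa> N = carrier N"
        by (rule M.cyclic_copy_properties[OF x(1) a])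
      show "\<pp> \<in> ideal_variety R \<aa>"
        using h'[OF N(1)] N(2,3) T x(2) by blast
    qed
  next
    assume W: "weak_assassin R M \<subseteq> ideal_variety R \<aa>"
    have "x \<in> torsion_part R \<aa> M" if x: "x \<in> carrier M" for x
    proof -
      obtain N :: "('r, 'r set) module" where N: "module R N"
        "weak_assassin R N \<subseteq> weak_assassin R M"
        "torsion_part R \<aa> N = carrier N \<longrightarrow> x \<in> torsion_part R \<aa> M"
        by (rule M.cyclic_copy_properties[OF x a])
      show ?thesis using h'[OF N(1)] N(2,3) W by blast
    qed
    then show "torsion_part R \<aa> M = carrier M" by (auto simp: torsion_part_def)
  }
qed

lemma centred_universal:
  assumes a: "ideal \<aa> R" and h: "centred TYPE('r set) R (\<aa> :: 'r set)"
  shows "centred TYPE('m) R \<aa>"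
  unfolding centred_def
proof (intro allI impI iffI)
  fix M :: "('r, 'm) module" assume "module R M"
  then interpret M: module R M .
  note h' = h[unfolded centred_def, rule_format]
  {
    assume T: "torsion_part R \<aa> M = {\<zero>\<^bsub>M\<^esub>}"
    have "\<pp> \<notin> ideal_variety R \<aa>" if "\<pp> \<in> weak_assassin R M" for \<pp>
    proof -
      from that obtain x where x: "x \<in> carrier M" "\<pp> \<in> minimal_primes R (elem_annihilator R M x)"
        by (auto simp: weak_assassin_def)
      obtain N :: "('r, 'r set) module" where N: "module R N"
        "minimal_primes R (elem_annihilator R M x) \<subseteq> weak_assassin R N"
        "torsion_part R \<aa> M = {\<zero>\<^bsub>M\<^esub>} \<longrightarrow> torsion_part R \<aa> N = {\<zero>\<^bsub>N\<^esub>}"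
        by (rule M.cyclic_copy_properties[OF x(1) a])
      show ?thesis
        using h'[OF N(1)] N(2,3) T x(2) by blast
    qed
    then show "weak_assassin R M \<inter> ideal_variety R \<aa> = {}" by blast
  next
    assume W: "weak_assassin R M \<inter> ideal_variety R \<aa> = {}"
    have "x = \<zero>\<^bsub>M\<^esub>" if xT: "x \<in> torsion_part R \<aa> M" for x
    proof -
      have x: "x \<in> carrier M" using xT by (simp add: torsion_part_def)
      obtain N :: "('r, 'r set) module" where N: "module R N"
        "weak_assassin R N \<subseteq> weak_assassin R M"
        "torsion_part R \<aa> N = {\<zero>\<^bsub>N\<^esub>} \<longrightarrow> x \<in> torsion_part R \<aa> M \<longrightarrow> x = \<zero>\<^bsub>M\<^esub>"
        by (rule M.cyclic_copy_properties[OF x a])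
      show ?thesis using h'[OF N(1)] N(2,3) xT W by blast
    qed
    moreover have "\<zero>\<^bsub>M\<^esub> \<in> torsion_part R \<aa> M"
      using M.torsion_submodule[OF a] subgroup.one_closed by (force simp: submodule_def)
    ultimately show "torsion_part R \<aa> M = {\<zero>\<^bsub>M\<^esub>}" by blast
  }
qed

lemma weakly_fair_universal:
  assumes a: "ideal \<aa> R" and h: "weakly_fair TYPE('r set) R (\<aa> :: 'r set)"
  shows "weakly_fair TYPE('m) R \<aa>"
  unfolding weakly_fair_def
proof (intro allI impI equalityI subsetI)
  fix M :: "('r, 'm) module" assume "module R M"
  then interpret M: module R M .
  note h' = h[unfolded weakly_fair_def, rule_format]
  let ?Q = "quot_module M (torsion_part R \<aa> M)"
  {
    fix \<pp> assume "\<pp> \<in> weak_assassin R ?Q"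
    then obtain x where x: "x \<in> carrier M"
      "\<pp> \<in> minimal_primes R (elem_annihilator R ?Q (torsion_part R \<aa> M +>\<^bsub>M\<^esub> x))"
      by (auto simp: weak_assassin_def M.carrier_quot)
    obtain N :: "('r, 'r set) module" where N: "module R N"
      "weak_assassin R N \<subseteq> weak_assassin R M"
      "minimal_primes R (elem_annihilator R ?Q (torsion_part R \<aa> M +>\<^bsub>M\<^esub> x))
         \<subseteq> weak_assassin R (quot_module N (torsion_part R \<aa> N))"
      by (rule M.cyclic_copy_properties[OF x(1) a])
    show "\<pp> \<in> weak_assassin R M - ideal_variety R \<aa>"
      using h'[OF N(1)] N(2,3) x(2) by blast
  next
    fix \<pp> assume p: "\<pp> \<in> weak_assassin R M - ideal_variety R \<aa>"
    then obtain x where x: "x \<in> carrier M" "\<pp> \<in> minimal_primes R (elem_annihilator R M x)"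
      by (auto simp: weak_assassin_def)
    obtain N :: "('r, 'r set) module" where N: "module R N"
      "minimal_primes R (elem_annihilator R M x) \<subseteq> weak_assassin R N"
      "weak_assassin R (quot_module N (torsion_part R \<aa> N)) \<subseteq> weak_assassin R ?Q"
      by (rule M.cyclic_copy_properties[OF x(1) a])
    show "\<pp> \<in> weak_assassin R ?Q"
      using h'[OF N(1)] N(2,3) x(2) p by blast
  }
qed

end

theory Submission
  imports Defs
begin

text \<open>Passing from \<open>\<aa>\<close> and \<open>\<bb>\<close> to \<open>\<aa> + \<bb>\<close> turns both sides of the defining equivalences
  into intersections: \<open>Var(\<aa> + \<bb>) = Var(\<aa>) \<inter> Var(\<bb>)\<close> (lemma \<open>ideal_variety_add\<close>) and
  \<open>\<Gamma>\<^sub>\<aa>\<^sub>+\<^sub>\<bb>(M) = \<Gamma>\<^sub>\<aa>(M) \<inter> \<Gamma>\<^sub>\<bb>(M)\<close> (lemma \<open>torsion_add\<close>). For half-centredness that is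
  already the proof, since an intersection is everything iff both of its members are.

  For centredness an intersection has to be shown to vanish, so the two torsion functors are
  composed instead: with \<open>N = \<Gamma>\<^sub>\<bb>(M)\<close> one has \<open>\<Gamma>\<^sub>\<aa>\<^sub>+\<^sub>\<bb>(M) = \<Gamma>\<^sub>\<aa>(N)\<close>, and centredness of \<open>\<aa>\<close> can
  be applied to \<open>N\<close>. This gives the claim as soon as \<open>Ass(N) = Ass(M) \<inter> Var(\<bb>)\<close>
  (lemma \<open>weak_assassin_torsion\<close>). The inclusion from left to right holds for every \<open>\<bb>\<close>. For
  the other one, \<open>Ass(M) \<subseteq> Ass(N) \<union> Ass(M/N)\<close> reduces the question to
  \<open>Ass(M/N) \<inter> Var(\<bb>) = \<emptyset>\<close>. That is part of the definition if \<open>\<bb>\<close> is weakly fair. If \<open>\<bb>\<close> is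
  well-centred, then half-centredness makes \<open>\<Gamma>\<^sub>\<bb>\<close> a radical, that is, \<open>\<Gamma>\<^sub>\<bb>(M/N) = 0\<close>
  (lemma \<open>half_centred_imp_radical\<close>), and centredness of \<open>\<bb>\<close> is applied to \<open>M/N\<close>.

  The last application meets a typing obstacle: the hypotheses concern modules whose carrier lies
  in one fixed type, while the elements of \<open>M/N\<close> are sets over that type. A choice of coset
  representatives puts a copy of \<open>M/N\<close> back into it (lemmas \<open>centredD_inj\<close> and
  \<open>quot_carrier_inj\<close>).\<close>

section \<open>Minimal primes\<close>

lemma ideals_set_one: "\<one>\<^bsub>ideals_set R\<^esub> = carrier R"
  by (simp add: ideals_set_def)

lemma ideal_pow_Suc: "\<aa> [^]\<^bsub>ideals_set R\<^esub> Suc n = (\<aa> [^]\<^bsub>ideals_set R\<^esub> n) \<cdot>\<^bsub>R\<^esub> \<aa>"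
  by (simp add: nat_pow_def ideals_set_def)

lemma ideal_pow_subset_primeD:
  assumes a: "ideal \<aa> R" and p: "primeideal \<pp> R"
    and sub: "\<aa> [^]\<^bsub>ideals_set R\<^esub> (n::nat) \<subseteq> \<pp>"
  shows "\<aa> \<subseteq> \<pp>"
proof (rule ccontr)
  interpret p: primeideal \<pp> R by (rule p)
  interpret a: ideal \<aa> R by (rule a)
  assume "\<not> \<aa> \<subseteq> \<pp>"
  then obtain c where c: "c \<in> \<aa>" "c \<notin> \<pp>" by blast
  then have cR: "c \<in> carrier R" by (simp add: a.Icarr)
  have "\<exists>d \<in> \<aa> [^]\<^bsub>ideals_set R\<^esub> n. d \<in> carrier R \<and> d \<notin> \<pp>" for n :: nat
  proof (induction n)
    case 0
    have "\<one>\<^bsub>R\<^esub> \<notin> \<pp>" using p.I_notcarr p.one_imp_carrier by blast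
    then show ?case by (auto simp: ideals_set_one)
  next
    case (Suc n)
    then obtain d where "d \<in> \<aa> [^]\<^bsub>ideals_set R\<^esub> n" "d \<in> carrier R" "d \<notin> \<pp>" by blast
    then show ?case
      using c cR p.I_prime[of d c] unfolding ideal_pow_Suc
      by (intro bexI[of _ "d \<otimes>\<^bsub>R\<^esub> c"]) (auto intro: ideal_prod.prod)
  qed
  then show False using sub by blast
qed

lemma (in ring) ideal_variety_add:
  assumes a: "ideal \<aa> R" and b: "ideal \<bb> R"
  shows "ideal_variety R (\<aa> <+>\<^bsub>R\<^esub> \<bb>) = ideal_variety R \<aa> \<inter> ideal_variety R \<bb>"
proof -
  have "\<aa> <+>\<^bsub>R\<^esub> \<bb> \<subseteq> \<pp> \<longleftrightarrow> \<aa> \<subseteq> \<pp> \<and> \<bb> \<subseteq> \<pp>" if "primeideal \<pp> R" for \<pp>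
  proof -
    interpret p: primeideal \<pp> R by (rule that)
    show ?thesis
      using union_genideal[OF a b] genideal_minimal[OF p.is_ideal, of "\<aa> \<union> \<bb>"]
        genideal_self[of "\<aa> \<union> \<bb>"] ideal.Icarr[OF a] ideal.Icarr[OF b] by blast
  qed
  then show ?thesis by (auto simp: ideal_variety_def)
qed

lemma minimal_primes_between:
  assumes "\<pp> \<in> minimal_primes R I" "I \<subseteq> J" "J \<subseteq> \<pp>"
  shows "\<pp> \<in> minimal_primes R J"
  using assms(1) order_trans[OF assms(2)] assms(3)
  by (simp add: minimal_primes_def ideal_variety_def)

lemma minimal_primesD:
  assumes "\<pp> \<in> minimal_primes R I"
  shows "primeideal \<pp> R" "I \<subseteq> \<pp>"
  using assms by (auto simp: minimal_primes_def ideal_variety_def)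

lemma weak_assassin_iff:
  "\<pp> \<in> weak_assassin R M \<longleftrightarrow> (\<exists>x \<in> carrier M. \<pp> \<in> minimal_primes R (elem_annihilator R M x))"
  by (auto simp: weak_assassin_def dest: minimal_primesD)

context module
begin

lemma ann_smult_mono:
  assumes r: "r \<in> carrier R" and x: "x \<in> carrier M"
  shows "elem_annihilator R M x \<subseteq> elem_annihilator R M (r \<odot>\<^bsub>M\<^esub> x)"
proof
  fix s assume s: "s \<in> elem_annihilator R M x"
  then have sR: "s \<in> carrier R" by (simp add: elem_annihilator_def)
  have "s \<odot>\<^bsub>M\<^esub> (r \<odot>\<^bsub>M\<^esub> x) = r \<odot>\<^bsub>M\<^esub> (s \<odot>\<^bsub>M\<^esub> x)"
    using smult_assoc1[OF r sR x] smult_assoc1[OF sR r x] R.m_comm[OF r sR] by simp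
  then show "s \<in> elem_annihilator R M (r \<odot>\<^bsub>M\<^esub> x)"
    using s r by (simp add: elem_annihilator_def)
qed

text \<open>If \<open>r \<notin> \<pp>\<close> then \<open>s r x = 0\<close> forces \<open>s \<in> \<pp>\<close>, so \<open>Ann(x) \<subseteq> Ann(r x) \<subseteq> \<pp>\<close>. This allows a
  generator \<open>x\<close> of a member of the assassin to be moved into a submodule that contains
  \<open>r x\<close>.\<close>

lemma minimal_primes_ann_smult:
  assumes p: "\<pp> \<in> minimal_primes R (elem_annihilator R M x)"
    and x: "x \<in> carrier M" and r: "r \<in> carrier R" "r \<notin> \<pp>"
  shows "\<pp> \<in> minimal_primes R (elem_annihilator R M (r \<odot>\<^bsub>M\<^esub> x))"
proof (rule minimal_primes_between[OF p ann_smult_mono[OF r(1) x]])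
  interpret p: primeideal \<pp> R by (rule minimal_primesD[OF p])
  show "elem_annihilator R M (r \<odot>\<^bsub>M\<^esub> x) \<subseteq> \<pp>"
  proof
    fix s assume s: "s \<in> elem_annihilator R M (r \<odot>\<^bsub>M\<^esub> x)"
    then have "s \<otimes> r \<in> elem_annihilator R M x"
      using r x by (auto simp: elem_annihilator_def smult_assoc1)
    then have "s \<otimes> r \<in> \<pp>" using minimal_primesD(2)[OF p] by blast
    then show "s \<in> \<pp>" using p.I_prime s r by (auto simp: elem_annihilator_def)
  qed
qed


section \<open>Submodules and quotients\<close>

lemma module_restrict:
  assumes "submodule H R M"
  shows "module R (M\<lparr>carrier := H\<rparr>)"
  using submodule.submodule_is_module[OF assms] module_axioms by blast

lemma ann_restrict: "elem_annihilator R (M\<lparr>carrier := H\<rparr>) = elem_annihilator R M"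
  by (simp add: elem_annihilator_def fun_eq_iff)

lemma torsion_restrict:
  assumes "submodule H R M"
  shows "torsion_part R \<aa> (M\<lparr>carrier := H\<rparr>) = torsion_part R \<aa> M \<inter> H"
  using submoduleE(1)[OF assms] by (auto simp: torsion_part_def ann_restrict)

lemma weak_assassin_restrict_subset:
  assumes "submodule H R M"
  shows "weak_assassin R (M\<lparr>carrier := H\<rparr>) \<subseteq> weak_assassin R M"
  using submoduleE(1)[OF assms] by (auto simp: weak_assassin_def ann_restrict)

text \<open>For \<open>\<pp>\<close> minimal over \<open>Ann(x)\<close>, compare \<open>\<pp>\<close> with the annihilator \<open>J\<close> of the image of \<open>x\<close> in the
  quotient. Either \<open>J \<subseteq> \<pp>\<close>, and \<open>\<pp>\<close> is minimal over \<open>J\<close> too because \<open>Ann(x) \<subseteq> J\<close>; or some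
  \<open>r \<in> J\<close> lies outside \<open>\<pp>\<close>, and \<open>\<pp>\<close> is minimal over the annihilator of \<open>r x \<in> H\<close>.\<close>

lemma weak_assassin_extension:
  assumes H: "submodule H R M"
  shows "weak_assassin R M
    \<subseteq> weak_assassin R (M\<lparr>carrier := H\<rparr>) \<union> weak_assassin R (quot_module M H)"
proof
  fix \<pp> assume "\<pp> \<in> weak_assassin R M"
  then obtain x where x: "x \<in> carrier M" and p: "\<pp> \<in> minimal_primes R (elem_annihilator R M x)"
    by (auto simp: weak_assassin_iff)
  let ?J = "elem_annihilator R (quot_module M H) (H +>\<^bsub>M\<^esub> x)"
  have J: "?J = {s \<in> carrier R. s \<odot>\<^bsub>M\<^esub> x \<in> H}" by (rule ann_quot[OF H x])
  show "\<pp> \<in> weak_assassin R (M\<lparr>carrier := H\<rparr>) \<union> weak_assassin R (quot_module M H)"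
  proof (cases "?J \<subseteq> \<pp>")
    case True
    have "elem_annihilator R M x \<subseteq> ?J"
      unfolding J using H by (auto simp: elem_annihilator_def submodule_def subgroup_def)
    then have "\<pp> \<in> minimal_primes R ?J" using minimal_primes_between[OF p _ True] by blast
    then show ?thesis using x by (auto simp: weak_assassin_iff carrier_quot)
  next
    case False
    then obtain r where "r \<in> carrier R" "r \<odot>\<^bsub>M\<^esub> x \<in> H" "r \<notin> \<pp>" unfolding J by blast
    then show ?thesis
      using minimal_primes_ann_smult[OF p x] by (auto simp: weak_assassin_iff ann_restrict)
  qed
qed

lemma cyclic_submodule:
  assumes x: "x \<in> carrier M"
  shows "submodule ((\<lambda>r. r \<odot>\<^bsub>M\<^esub> x) ` carrier R) R M"
    (is "submodule ?H R M")
proof (rule submoduleI)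
  show "?H \<subseteq> carrier M" using x by auto
  show "\<zero>\<^bsub>M\<^esub> \<in> ?H" by (rule image_eqI[of _ _ \<zero>]) (simp_all add: x)
next
  fix y assume "y \<in> ?H"
  then obtain r where r: "r \<in> carrier R" "y = r \<odot>\<^bsub>M\<^esub> x" by blast
  show "\<ominus>\<^bsub>M\<^esub> y \<in> ?H"
    by (rule image_eqI[of _ _ "\<ominus> r"]) (simp_all add: r x smult_l_minus)
next
  fix y z assume "y \<in> ?H" "z \<in> ?H"
  then obtain r s where rs: "r \<in> carrier R" "y = r \<odot>\<^bsub>M\<^esub> x" "s \<in> carrier R" "z = s \<odot>\<^bsub>M\<^esub> x"
    by blast
  show "y \<oplus>\<^bsub>M\<^esub> z \<in> ?H"
    by (rule image_eqI[of _ _ "r \<oplus> s"]) (simp_all add: rs x smult_l_distr)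
next
  fix r y assume r: "r \<in> carrier R" and "y \<in> ?H"
  then obtain s where s: "s \<in> carrier R" "y = s \<odot>\<^bsub>M\<^esub> x" by blast
  show "r \<odot>\<^bsub>M\<^esub> y \<in> ?H"
    by (rule image_eqI[of _ _ "r \<otimes> s"]) (simp_all add: r s x smult_assoc1)
qed

text \<open>Torsion and weak assassins depend only on the annihilators of the elements, so equality of
  annihilators is all that is needed to know about the copy.\<close>

lemma transport_module:
  fixes f :: "'c \<Rightarrow> 'm"
  assumes inj: "inj_on f (carrier M)"
  obtains N :: "('a, 'm) module" where "module R N" "carrier N = f ` carrier M"
    "\<zero>\<^bsub>N\<^esub> = f \<zero>\<^bsub>M\<^esub>"
    "\<And>x. x \<in> carrier M \<Longrightarrow> elem_annihilator R N (f x) = elem_annihilator R M x"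
proof -
  define g where "g = the_inv_into (carrier M) f"
  have g [simp]: "g (f x) = x" if "x \<in> carrier M" for x
    using the_inv_into_f_f[OF inj that] by (simp add: g_def)
  define N :: "('a, 'm) module" where
    "N = \<lparr>carrier = f ` carrier M, mult = undefined, one = undefined, zero = f \<zero>\<^bsub>M\<^esub>,
      add = (\<lambda>y z. f (g y \<oplus>\<^bsub>M\<^esub> g z)), smult = (\<lambda>r y. f (r \<odot>\<^bsub>M\<^esub> g y))\<rparr>"
  have ab: "abelian_group N"
  proof (rule abelian_groupI)
    fix y assume "y \<in> carrier N"
    then obtain x where "x \<in> carrier M" "y = f x" by (auto simp: N_def)
    then show "\<exists>z\<in>carrier N. z \<oplus>\<^bsub>N\<^esub> y = \<zero>\<^bsub>N\<^esub>"
      by (auto simp: N_def M.l_neg intro!: bexI[of _ "\<ominus>\<^bsub>M\<^esub> x"])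
  qed (auto simp: N_def M.a_ac)
  have N: "module R N"
    by (rule moduleI[OF R.is_cring ab])
      (auto simp: N_def smult_l_distr smult_r_distr smult_assoc1)
  have ann: "elem_annihilator R N (f x) = elem_annihilator R M x" if "x \<in> carrier M" for x
    using that inj by (auto simp: elem_annihilator_def N_def inj_on_eq_iff)
  show thesis by (rule that[OF N _ _ ann]) (simp_all add: N_def)
qed

lemma centredD_inj:
  fixes f :: "'c \<Rightarrow> 'm"
  assumes cent: "centred TYPE('m) R \<aa>" and inj: "inj_on f (carrier M)"
    and T: "torsion_part R \<aa> M = {\<zero>\<^bsub>M\<^esub>}"
  shows "weak_assassin R M \<inter> ideal_variety R \<aa> = {}"
proof -
  obtain N :: "('a, 'm) module" where N: "module R N" "carrier N = f ` carrier M"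
    "\<zero>\<^bsub>N\<^esub> = f \<zero>\<^bsub>M\<^esub>"
    "\<And>x. x \<in> carrier M \<Longrightarrow> elem_annihilator R N (f x) = elem_annihilator R M x"
    by (rule transport_module[OF inj]) blast
  define P where "P I \<longleftrightarrow> (\<exists>n::nat. \<aa> [^]\<^bsub>ideals_set R\<^esub> n \<subseteq> I)" for I
  have "torsion_part R \<aa> N = f ` torsion_part R \<aa> M"
    unfolding torsion_part_def P_def[symmetric] N(2) using N(4) by auto
  then have "torsion_part R \<aa> N = {\<zero>\<^bsub>N\<^esub>}" using T N(3) by simp
  moreover have "weak_assassin R N = weak_assassin R M"
    using N(2,4) by (auto simp: weak_assassin_def)
  ultimately show ?thesis using cent N(1) unfolding centred_def by metis
qed

lemma quot_carrier_inj: "\<exists>f :: 'c set \<Rightarrow> 'c. inj_on f (carrier (quot_module M H))"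
proof -
  define f :: "'c set \<Rightarrow> 'c" where "f = inv_into (carrier M) (\<lambda>x. H +>\<^bsub>M\<^esub> x)"
  show ?thesis unfolding carrier_quot by (rule exI[of _ f]) (simp add: f_def inj_on_inv_into)
qed


section \<open>Torsion\<close>

text \<open>The usual binomial argument, without binomials: peeling one factor \<open>c \<in> \<aa> \<union> \<bb>\<close> off the power
  replaces \<open>x\<close> by \<open>c x\<close>, which needs one factor of \<open>\<aa>\<close> or one of \<open>\<bb>\<close> less to be annihilated.\<close>

lemma ideal_pow_add_subset_ann:
  assumes a: "ideal \<aa> R" and b: "ideal \<bb> R" and "x \<in> carrier M"
    and "\<aa> [^]\<^bsub>ideals_set R\<^esub> (m::nat) \<subseteq> elem_annihilator R M x"
    and "\<bb> [^]\<^bsub>ideals_set R\<^esub> (n::nat) \<subseteq> elem_annihilator R M x"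
  shows "(\<aa> <+>\<^bsub>R\<^esub> \<bb>) [^]\<^bsub>ideals_set R\<^esub> (m + n) \<subseteq> elem_annihilator R M x"
  using assms(3-5)
proof (induction "m + n" arbitrary: m n x)
  case 0
  then show ?case by (simp add: ideals_set_one)
next
  case (Suc k)
  note x = Suc.prems(1) and am = Suc.prems(2) and bn = Suc.prems(3)
  note ann_add = additive_subgroup.a_closed[OF ideal.axioms(1)[OF ann_ideal[OF x]]]
  have ab: "ideal (\<aa> <+>\<^bsub>R\<^esub> \<bb>) R" by (rule R.add_ideals[OF a b])
  let ?P = "(\<aa> <+>\<^bsub>R\<^esub> \<bb>) [^]\<^bsub>ideals_set R\<^esub> k"
  show ?case
  proof (cases "m = 0 \<or> n = 0")
    case True
    then have "carrier R \<subseteq> elem_annihilator R M x" using am bn by (auto simp: ideals_set_one)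
    then show ?thesis using ideal.Icarr[OF ideal_pow[OF ab]] by blast
  next
    case False
    then obtain m' n' where mn: "m = Suc m'" "n = Suc n'" by (auto simp: gr0_conv_Suc)
    have step: "\<cc> [^]\<^bsub>ideals_set R\<^esub> j \<subseteq> elem_annihilator R M (c \<odot>\<^bsub>M\<^esub> x)"
      if "ideal \<cc> R" "c \<in> \<cc>" "\<cc> [^]\<^bsub>ideals_set R\<^esub> Suc j \<subseteq> elem_annihilator R M x" for \<cc> c j
    proof
      fix u assume u: "u \<in> \<cc> [^]\<^bsub>ideals_set R\<^esub> j"
      have "u \<otimes> c \<in> elem_annihilator R M x"
        using ideal_prod.prod[OF u that(2), of R] that(3) unfolding ideal_pow_Suc by blast
      then show "u \<in> elem_annihilator R M (c \<odot>\<^bsub>M\<^esub> x)"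
        using x ideal.Icarr[OF that(1,2)] ideal.Icarr[OF ideal_pow[OF that(1)] u]
        by (simp add: elem_annihilator_def smult_assoc1)
    qed
    have A: "?P \<subseteq> elem_annihilator R M (c \<odot>\<^bsub>M\<^esub> x)" if c: "c \<in> \<aa>" for c
    proof -
      have cR: "c \<in> carrier R" by (rule ideal.Icarr[OF a c])
      have k: "k = m' + n" using Suc.hyps(2) mn by simp
      show ?thesis
        unfolding k
        by (rule Suc.hyps(1)[OF k smult_closed[OF cR x] step[OF a c am[unfolded mn]]
              subset_trans[OF bn ann_smult_mono[OF cR x]]])
    qed
    have B: "?P \<subseteq> elem_annihilator R M (c \<odot>\<^bsub>M\<^esub> x)" if c: "c \<in> \<bb>" for c
    proof -
      have cR: "c \<in> carrier R" by (rule ideal.Icarr[OF b c])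
      have k: "k = m + n'" using Suc.hyps(2) mn by simp
      show ?thesis
        unfolding k
        by (rule Suc.hyps(1)[OF k smult_closed[OF cR x]
              subset_trans[OF am ann_smult_mono[OF cR x]] step[OF b c bn[unfolded mn]]])
    qed
    have "v \<in> elem_annihilator R M x" if "v \<in> ?P \<cdot> (\<aa> <+>\<^bsub>R\<^esub> \<bb>)" for v
      using that
    proof (induction v rule: ideal_prod.induct)
      case (prod u c)
      then obtain c1 c2 where c: "c1 \<in> \<aa>" "c2 \<in> \<bb>" "c = c1 \<oplus> c2"
        by (auto simp: set_add_def')
      have carr: "u \<in> carrier R" "c1 \<in> carrier R" "c2 \<in> carrier R"
        using ideal.Icarr[OF ideal_pow[OF ab] prod(1)] ideal.Icarr[OF a c(1)]
          ideal.Icarr[OF b c(2)] by auto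
      have "u \<otimes> c1 \<in> elem_annihilator R M x" "u \<otimes> c2 \<in> elem_annihilator R M x"
        using A[OF c(1)] B[OF c(2)] prod(1) carr x
        by (auto simp: elem_annihilator_def smult_assoc1)
      then show ?case using carr ann_add by (simp add: c(3) R.r_distr)
    qed (rule ann_add)
    then show ?thesis unfolding Suc.hyps(2)[symmetric] ideal_pow_Suc by blast
  qed
qed

lemma ideal_pow_mono:
  assumes "\<aa> \<subseteq> \<cc>"
  shows "\<aa> [^]\<^bsub>ideals_set R\<^esub> (n::nat) \<subseteq> \<cc> [^]\<^bsub>ideals_set R\<^esub> n"
proof (induction n)
  case (Suc n)
  have "v \<in> (\<cc> [^]\<^bsub>ideals_set R\<^esub> n) \<cdot>\<^bsub>R\<^esub> \<cc>" if "v \<in> (\<aa> [^]\<^bsub>ideals_set R\<^esub> n) \<cdot>\<^bsub>R\<^esub> \<aa>" for v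
    using that by induction (use Suc assms in \<open>auto intro: ideal_prod.intros\<close>)
  then show ?case unfolding ideal_pow_Suc by blast
qed (simp add: ideals_set_one)

lemma torsion_add:
  assumes a: "ideal \<aa> R" and b: "ideal \<bb> R"
  shows "torsion_part R (\<aa> <+>\<^bsub>R\<^esub> \<bb>) M = torsion_part R \<aa> M \<inter> torsion_part R \<bb> M"
proof -
  have "\<aa> \<union> \<bb> \<subseteq> \<aa> <+>\<^bsub>R\<^esub> \<bb>"
    using R.union_genideal[OF a b] R.genideal_self[of "\<aa> \<union> \<bb>"]
      ideal.Icarr[OF a] ideal.Icarr[OF b] by blast
  then have "\<aa> [^]\<^bsub>ideals_set R\<^esub> n \<union> \<bb> [^]\<^bsub>ideals_set R\<^esub> n \<subseteq> (\<aa> <+>\<^bsub>R\<^esub> \<bb>) [^]\<^bsub>ideals_set R\<^esub> n" for n :: nat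
    using ideal_pow_mono by simp
  then have "torsion_part R (\<aa> <+>\<^bsub>R\<^esub> \<bb>) M \<subseteq> torsion_part R \<aa> M \<inter> torsion_part R \<bb> M"
    unfolding torsion_part_def by fast
  moreover have "torsion_part R \<aa> M \<inter> torsion_part R \<bb> M \<subseteq> torsion_part R (\<aa> <+>\<^bsub>R\<^esub> \<bb>) M"
    using ideal_pow_add_subset_ann[OF a b] unfolding torsion_part_def by blast
  ultimately show ?thesis by (rule equalityI)
qed

lemma weak_assassin_torsion_subset:
  assumes b: "ideal \<bb> R"
  shows "weak_assassin R (M\<lparr>carrier := torsion_part R \<bb> M\<rparr>)
    \<subseteq> weak_assassin R M \<inter> ideal_variety R \<bb>"
proof -
  have "\<pp> \<in> ideal_variety R \<bb>"
    if ass: "\<pp> \<in> weak_assassin R (M\<lparr>carrier := torsion_part R \<bb> M\<rparr>)" for \<pp>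
  proof -
    obtain x where x: "x \<in> torsion_part R \<bb> M"
      and p: "\<pp> \<in> minimal_primes R (elem_annihilator R M x)"
      using ass by (auto simp: weak_assassin_iff ann_restrict)
    obtain n :: nat where "\<bb> [^]\<^bsub>ideals_set R\<^esub> n \<subseteq> elem_annihilator R M x"
      using x unfolding torsion_part_def by blast
    then show ?thesis
      using ideal_pow_subset_primeD[OF b minimal_primesD(1)[OF p], of n] minimal_primesD[OF p]
      by (auto simp: ideal_variety_def)
  qed
  then show ?thesis
    using weak_assassin_restrict_subset[OF torsion_submodule[OF b]] by blast
qed

text \<open>The hypothesis says that \<open>x\<close> is torsion modulo the torsion part. If \<open>\<pp>\<close> did not contain
  \<open>\<bb>\<^sup>n\<close>, then \<open>\<pp>\<close> would be minimal over the annihilator of some torsion element \<open>s x\<close>, and hence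
  contain \<open>\<bb>\<close>. So extensions of torsion modules by torsion modules have their weak assassin
  inside the variety, whether or not they are torsion.\<close>

lemma minimal_prime_variety_if_power_torsion:
  assumes b: "ideal \<bb> R" and x: "x \<in> carrier M"
    and tors: "\<And>s. s \<in> \<bb> [^]\<^bsub>ideals_set R\<^esub> (n::nat) \<Longrightarrow> s \<odot>\<^bsub>M\<^esub> x \<in> torsion_part R \<bb> M"
    and p: "\<pp> \<in> minimal_primes R (elem_annihilator R M x)"
  shows "\<pp> \<in> ideal_variety R \<bb>"
proof (cases "\<bb> [^]\<^bsub>ideals_set R\<^esub> n \<subseteq> \<pp>")
  case True
  then show ?thesis
    using ideal_pow_subset_primeD[OF b minimal_primesD(1)[OF p]] minimal_primesD(1)[OF p]
    by (auto simp: ideal_variety_def)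
next
  case False
  then obtain s where s: "s \<in> \<bb> [^]\<^bsub>ideals_set R\<^esub> n" "s \<notin> \<pp>" by blast
  then have "\<pp> \<in> minimal_primes R (elem_annihilator R M (s \<odot>\<^bsub>M\<^esub> x))"
    using minimal_primes_ann_smult[OF p x] ideal.Icarr[OF ideal_pow[OF b]] by blast
  then have "\<pp> \<in> weak_assassin R (M\<lparr>carrier := torsion_part R \<bb> M\<rparr>)"
    using tors[OF s(1)] by (auto simp: weak_assassin_iff ann_restrict)
  then show ?thesis using weak_assassin_torsion_subset[OF b] by blast
qed

end

text \<open>If the coset of \<open>x\<close> is torsion, the preceding lemma places the weak assassin of the cyclic
  module \<open>R x\<close> inside \<open>Var(\<bb>)\<close>; half-centredness, applied to \<open>R x\<close>, then makes \<open>x\<close> itself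
  torsion.\<close>

lemma half_centred_imp_radical:
  fixes M :: "('r, 'm) module"
  assumes M: "module R M" and b: "ideal \<bb> R" and half: "half_centred TYPE('m) R \<bb>"
  defines "T \<equiv> torsion_part R \<bb> M"
  shows "torsion_part R \<bb> (quot_module M T) = {\<zero>\<^bsub>quot_module M T\<^esub>}"
proof -
  interpret module R M by (rule M)
  have T: "submodule T R M" unfolding T_def by (rule torsion_submodule[OF b])
  interpret T: abelian_subgroup T M by (rule submodule_abelian_subgroup[OF T])
  interpret Q: module R "quot_module M T" by (rule quot_is_module[OF T])
  have "C = T" if C: "C \<in> torsion_part R \<bb> (quot_module M T)" for C
  proof -
    obtain x n where x: "x \<in> carrier M" "C = T +>\<^bsub>M\<^esub> x"
      and n: "\<bb> [^]\<^bsub>ideals_set R\<^esub> (n::nat) \<subseteq> {s \<in> carrier R. s \<odot>\<^bsub>M\<^esub> x \<in> T}"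
      using C by (auto simp: torsion_part_def carrier_quot ann_quot[OF T])
    define H where "H = (\<lambda>r. r \<odot>\<^bsub>M\<^esub> x) ` carrier R"
    have H: "submodule H R M" unfolding H_def by (rule cyclic_submodule[OF x(1)])
    have "weak_assassin R (M\<lparr>carrier := H\<rparr>) \<subseteq> ideal_variety R \<bb>"
    proof
      fix \<pp> assume "\<pp> \<in> weak_assassin R (M\<lparr>carrier := H\<rparr>)"
      then obtain r where r: "r \<in> carrier R"
        "\<pp> \<in> minimal_primes R (elem_annihilator R M (r \<odot>\<^bsub>M\<^esub> x))"
        by (auto simp: weak_assassin_iff H_def ann_restrict)
      have "s \<odot>\<^bsub>M\<^esub> (r \<odot>\<^bsub>M\<^esub> x) \<in> torsion_part R \<bb> M" if "s \<in> \<bb> [^]\<^bsub>ideals_set R\<^esub> n" for s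
      proof -
        have s: "s \<in> carrier R" "s \<odot>\<^bsub>M\<^esub> x \<in> T" using n that by auto
        then have "s \<odot>\<^bsub>M\<^esub> (r \<odot>\<^bsub>M\<^esub> x) = r \<odot>\<^bsub>M\<^esub> (s \<odot>\<^bsub>M\<^esub> x)"
          using r(1) x(1) by (simp add: smult_assoc1[symmetric] R.m_comm)
        then show ?thesis using submoduleE(4)[OF T r(1) s(2)] by (simp add: T_def)
      qed
      then show "\<pp> \<in> ideal_variety R \<bb>"
        by (rule minimal_prime_variety_if_power_torsion[OF b smult_closed[OF r(1) x(1)] _ r(2)])
    qed
    then have "torsion_part R \<bb> (M\<lparr>carrier := H\<rparr>) = carrier (M\<lparr>carrier := H\<rparr>)"
      using half module_restrict[OF H] unfolding half_centred_def by blast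
    moreover have "x \<in> H" unfolding H_def using x(1) by (auto intro!: image_eqI[of _ _ "\<one>\<^bsub>R\<^esub>"])
    ultimately have "x \<in> T" by (auto simp: torsion_restrict[OF H] T_def)
    then show ?thesis using x(2) T.a_rcos_const by simp
  qed
  moreover have "\<zero>\<^bsub>quot_module M T\<^esub> \<in> torsion_part R \<bb> (quot_module M T)"
    using Q.torsion_submodule[OF b] by (auto simp: submodule_def subgroup_def)
  ultimately show ?thesis by (auto simp: quot_zero)
qed

lemma weak_assassin_torsion:
  fixes M :: "('r, 'm) module"
  assumes M: "module R M" and b: "ideal \<bb> R"
    and disj: "well_centred TYPE('m) R \<bb> \<or> weakly_fair TYPE('m) R \<bb>"
  shows "weak_assassin R (M\<lparr>carrier := torsion_part R \<bb> M\<rparr>)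
    = weak_assassin R M \<inter> ideal_variety R \<bb>"
proof -
  interpret module R M by (rule M)
  let ?Q = "quot_module M (torsion_part R \<bb> M)"
  have T: "submodule (torsion_part R \<bb> M) R M" by (rule torsion_submodule[OF b])
  have "weak_assassin R ?Q \<inter> ideal_variety R \<bb> = {}"
    using disj
  proof
    assume "well_centred TYPE('m) R \<bb>"
    then have cent: "centred TYPE('m) R \<bb>" and half: "half_centred TYPE('m) R \<bb>"
      by (auto simp: well_centred_def)
    obtain f :: "'m set \<Rightarrow> 'm" where "inj_on f (carrier ?Q)" using quot_carrier_inj by blast
    then show ?thesis
      by (rule module.centredD_inj[OF quot_is_module[OF T] cent _
            half_centred_imp_radical[OF M b half]])
  next
    assume "weakly_fair TYPE('m) R \<bb>"
    then show ?thesis using M unfolding weakly_fair_def by blast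
  qed
  then show ?thesis
    using weak_assassin_extension[OF T] weak_assassin_torsion_subset[OF b] by blast
qed


section \<open>Sums of ideals\<close>

lemma half_centred_add:
  assumes a: "ideal \<aa> R" and b: "ideal \<bb> R"
    and ha: "half_centred TYPE('m) R \<aa>" and hb: "half_centred TYPE('m) R \<bb>"
  shows "half_centred TYPE('m) R (\<aa> <+>\<^bsub>R\<^esub> \<bb>)"
  unfolding half_centred_def
proof (intro allI impI)
  fix M :: "('a, 'm) module" assume M: "module R M"
  interpret module R M by (rule M)
  have sub: "torsion_part R \<cc> M \<subseteq> carrier M" for \<cc> by (auto simp: torsion_part_def)
  have "torsion_part R (\<aa> <+>\<^bsub>R\<^esub> \<bb>) M = carrier M
      \<longleftrightarrow> torsion_part R \<aa> M = carrier M \<and> torsion_part R \<bb> M = carrier M"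
    unfolding torsion_add[OF a b] using sub by blast
  also have "\<dots> \<longleftrightarrow> weak_assassin R M \<subseteq> ideal_variety R \<aa> \<and> weak_assassin R M \<subseteq> ideal_variety R \<bb>"
    using ha hb M unfolding half_centred_def by blast
  also have "\<dots> \<longleftrightarrow> weak_assassin R M \<subseteq> ideal_variety R (\<aa> <+>\<^bsub>R\<^esub> \<bb>)"
    unfolding R.ideal_variety_add[OF a b] by blast
  finally show "torsion_part R (\<aa> <+>\<^bsub>R\<^esub> \<bb>) M = carrier M
      \<longleftrightarrow> weak_assassin R M \<subseteq> ideal_variety R (\<aa> <+>\<^bsub>R\<^esub> \<bb>)" .
qed

lemma centred_add:
  assumes a: "ideal \<aa> R" and b: "ideal \<bb> R"
    and ca: "centred TYPE('m) R \<aa>"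
    and disj: "well_centred TYPE('m) R \<bb> \<or> weakly_fair TYPE('m) R \<bb>"
  shows "centred TYPE('m) R (\<aa> <+>\<^bsub>R\<^esub> \<bb>)"
  unfolding centred_def
proof (intro allI impI)
  fix M :: "('a, 'm) module" assume M: "module R M"
  interpret module R M by (rule M)
  define N where "N = M\<lparr>carrier := torsion_part R \<bb> M\<rparr>"
  have T: "submodule (torsion_part R \<bb> M) R M" by (rule torsion_submodule[OF b])
  have N: "module R N" unfolding N_def by (rule module_restrict[OF T])
  have "torsion_part R (\<aa> <+>\<^bsub>R\<^esub> \<bb>) M = {\<zero>\<^bsub>M\<^esub>} \<longleftrightarrow> torsion_part R \<aa> N = {\<zero>\<^bsub>N\<^esub>}"
    unfolding N_def by (simp add: torsion_restrict[OF T] torsion_add[OF a b])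
  also have "\<dots> \<longleftrightarrow> weak_assassin R N \<inter> ideal_variety R \<aa> = {}"
    using ca N unfolding centred_def by blast
  also have "\<dots> \<longleftrightarrow> weak_assassin R M \<inter> ideal_variety R (\<aa> <+>\<^bsub>R\<^esub> \<bb>) = {}"
    unfolding N_def weak_assassin_torsion[OF M b disj] R.ideal_variety_add[OF a b] by blast
  finally show "torsion_part R (\<aa> <+>\<^bsub>R\<^esub> \<bb>) M = {\<zero>\<^bsub>M\<^esub>}
      \<longleftrightarrow> weak_assassin R M \<inter> ideal_variety R (\<aa> <+>\<^bsub>R\<^esub> \<bb>) = {}" .
qed

theorem mainTheorem5:
  fixes R :: "('r, 'x) ring_scheme" and \<aa> \<bb> :: "'r set"
  assumes "cring R" and "ideal \<aa> R" and "ideal \<bb> R"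
  shows "(half_centred TYPE('m) R \<aa> \<and> half_centred TYPE('m) R \<bb>
            \<longrightarrow> half_centred TYPE('m) R (\<aa> <+>\<^bsub>R\<^esub> \<bb>))
       \<and> (centred TYPE('m) R \<aa> \<and> (well_centred TYPE('m) R \<bb> \<or> weakly_fair TYPE('m) R \<bb>)
            \<longrightarrow> centred TYPE('m) R (\<aa> <+>\<^bsub>R\<^esub> \<bb>))
       \<and> (well_centred TYPE('m) R \<aa> \<and> well_centred TYPE('m) R \<bb>
            \<longrightarrow> well_centred TYPE('m) R (\<aa> <+>\<^bsub>R\<^esub> \<bb>))"
proof (intro conjI impI; elim conjE)
  assume "half_centred TYPE('m) R \<aa>" "half_centred TYPE('m) R \<bb>"
  then show "half_centred TYPE('m) R (\<aa> <+>\<^bsub>R\<^esub> \<bb>)" by (rule half_centred_add[OF assms(2,3)])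
next
  assume "centred TYPE('m) R \<aa>" "well_centred TYPE('m) R \<bb> \<or> weakly_fair TYPE('m) R \<bb>"
  then show "centred TYPE('m) R (\<aa> <+>\<^bsub>R\<^esub> \<bb>)" by (rule centred_add[OF assms(2,3)])
next
  assume wa: "well_centred TYPE('m) R \<aa>" and wb: "well_centred TYPE('m) R \<bb>"
  have "centred TYPE('m) R (\<aa> <+>\<^bsub>R\<^esub> \<bb>)"
    by (rule centred_add[OF assms(2,3)]) (use wa wb in \<open>simp_all add: well_centred_def\<close>)
  moreover have "half_centred TYPE('m) R (\<aa> <+>\<^bsub>R\<^esub> \<bb>)"
    by (rule half_centred_add[OF assms(2,3)]) (use wa wb in \<open>simp_all add: well_centred_def\<close>)
  ultimately show "well_centred TYPE('m) R (\<aa> <+>\<^bsub>R\<^esub> \<bb>)" by (simp add: well_centred_def)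
qed

end
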